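(* Let $\sigma\in(0,1)$. Consider a line segment $\mathcal{L}\subseteq\mathbb{R}^2$, let $\mathcal{L}_e$ denote its extension to an infinite line, let $z\in\mathbb{R}^2\setminus\mathcal{L}_e$, and let $\mathbf{u}$ be a unit vector. Assume that $\mathcal{L}\subseteq\mathcal{P}_+:=\{p\in\mathbb{R}^2 \mid (p-z)\cdot\mathbf{u}\ge 0\}$. Choose a (Cartesian) coordinate system so that $z$ is at the origin and $\mathbf{u}$ points along the positive $y$-axis. Let $(r_i,\theta_i)$, $i=1,2$, denote the polar coordinates (with $r_i>0$, $\theta_i\in[0,\pi]$) of the end points of $\mathcal{L}$, labelled such that $\theta_1\le\theta_2$, and let $(r_m,\theta_m)$ (with $r_m>0$, $\theta_m\in[0,\pi]$) be the polar coordinates of the midpoint of $\mathcal{L}$. If $\theta_\perp\in(-\pi/2,3\pi/2)$ is the angle of the ray emanating from $z$ which is perpendicular to $\mathcal{L}_e$ (i.e. the ray from $z$ that meets $\mathcal{L}_e$ orthogonally), then $$\kappa_\sigma(z,\mathcal{L},\mathbf{u})=\frac{\sec^\sigma(\theta_m-\theta_\perp)}{\sigma\, r_m^\sigma}\Big(\Psi_\sigma(\sin(\theta_2-\theta_\perp))-\Psi_\sigma(\sin(\theta_1-\theta_\perp))\Big).$$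
   Context: The function $\Psi_\sigma$ is defined for $t\in[-1,1]$ by $$\Psi_\sigma(t)=\tfrac12\,\mathrm{sgn}(t)\,\beta_{t^2}\big(\tfrac12,\tfrac{1+\sigma}{2}\big),\qquad \beta_t(a,b)=\int_0^t u^{a-1}(1-u)^{b-1}\,du$$ ($\beta_t(a,b)$ is the incomplete beta function). Nonlocal curvature. An open line segment $\mathcal{J}$ and a (piecewise $C^1$, finite length, not necessarily connected) curve $\mathcal{C}\subseteq\mathbb{R}^2$ are transversal if at every $p\in\mathcal{J}\cap\mathcal{C}$ the tangent to $\mathcal{C}$ at $p$ is not parallel to $\mathcal{J}$. $\mathcal{X}(\mathcal{C})$ is the set of all pairs $(x,y)\in\mathbb{R}^2\times\mathbb{R}^2$ such that the open line segment $\mathcal{J}$ connecting $x$ and $y$ is transversal to $\mathcal{C}$ and $\mathcal{C}\cap\mathcal{J}$ has an odd number of elements; $\mathcal{X}(\mathcal{C})^c$ is its complement. For $z\in\mathcal{C}$ (a point where $\mathcal{C}$ is $C^1$) and a unit normal $\mathbf{u}$ to $\mathcal{C}$ at $z$, set $$\mathcal{A}_e(z)=\{y \mid ((z,y)\in\mathcal{X}(\mathcal{C})\text{ and }(z-y)\cdot\mathbf{u}>0)\text{ or }((z,y)\in\mathcal{X}(\mathcal{C})^c\text{ and }(z-y)\cdot\mathbf{u}<0)\},$$ $$\mathcal{A}_i(z)=\{y \mid ((z,y)\in\mathcal{X}(\mathcal{C})^c\text{ and }(z-y)\cdot\mathbf{u}>0)\text{ or }((z,y)\in\mathcal{X}(\mathcal{C})\text{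 and }(z-y)\cdot\mathbf{u}<0)\},$$ let $\widehat\chi_{\mathcal{C}}(z,y)$ equal $1$ if $y\in\mathcal{A}_i(z)$, $-1$ if $y\in\mathcal{A}_e(z)$, and $0$ otherwise, and define (principal value) $$\kappa_\sigma(z,\mathcal{C},\mathbf{u})=\lim_{\varepsilon\to0}\frac12\int_{\mathbb{R}^2\setminus B_\varepsilon(z)}\frac{\widehat\chi_{\mathcal{C}}(z,y)}{|z-y|^{2+\sigma}}\,dy,$$ where $B_\varepsilon(z)$ is the ball of radius $\varepsilon$ centered at $z$. For $z\notin\mathcal{C}$ and an arbitrary unit vector $\mathbf{u}$, define $$\kappa_\sigma(z,\mathcal{C},\mathbf{u})=\lim_{\delta\downarrow0}\kappa_\sigma(z,\mathcal{C}\cup[z-\delta\mathbf{u}^\perp,z+\delta\mathbf{u}^\perp],\mathbf{u}),$$ where $\mathbf{u}^\perp$ is $\mathbf{u}$ rotated clockwise by $90^\circ$ and $[x,y]$ is the line segment with endpoints $x,y$ (the right side is constant for small $\delta$). *)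

theory Defs
  imports "HOL-Analysis.Analysis"
begin

definition incomplete_beta :: "real \<Rightarrow> real \<Rightarrow> real \<Rightarrow> real" where
  "incomplete_beta t a b = integral {0..t} (\<lambda>u. u powr (a - 1) * (1 - u) powr (b - 1))"

definition Psi :: "real \<Rightarrow> real \<Rightarrow> real" where
  "Psi \<sigma> t = 1 / 2 * sgn t * incomplete_beta (t\<^sup>2) (1 / 2) ((1 + \<sigma>) / 2)"

text \<open>
  Tangency is phrased for an arbitrary set, so that it makes sense for a finite union of
  \<open>C\<^sup>1\<close> arcs given only as a point set. At a point where the curve is \<open>C\<^sup>1\<close> the nonzero
  velocities of arcs in the curve starting there span exactly the tangent line; at end points
  and corners they are the one-sided tangents. The library predicate
  \<open>C1_differentiable_on\<close> uses two-sided derivatives, so \<open>\<gamma>\<close> is differentiable at the end points of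
  \<open>{0..1}\<close> as well, but only its values on \<open>{0..1}\<close> are required to lie in the curve.
\<close>

definition tangent_vector :: "(real^2) set \<Rightarrow> real^2 \<Rightarrow> real^2 \<Rightarrow> bool" where
  "tangent_vector C p v \<longleftrightarrow> v \<noteq> 0 \<and>
     (\<exists>\<gamma>. \<gamma> C1_differentiable_on {0..1} \<and> \<gamma> ` {0..1} \<subseteq> C \<and> \<gamma> 0 = p \<and>
          (\<gamma> has_vector_derivative v) (at 0))"

definition transversal :: "real^2 \<Rightarrow> real^2 \<Rightarrow> (real^2) set \<Rightarrow> bool" where
  "transversal x y C \<longleftrightarrow>
     (\<forall>p \<in> open_segment x y \<inter> C. \<forall>v. tangent_vector C p v \<longrightarrow> v \<notin> span {y - x})"

text \<open>The cardinality of an infinite set is \<open>0\<close>, so \<open>odd (card _)\<close> includes finiteness.\<close>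

definition odd_crossing :: "(real^2) set \<Rightarrow> ((real^2) \<times> (real^2)) set" where
  "odd_crossing C = {(x, y). transversal x y C \<and> odd (card (C \<inter> open_segment x y))}"

definition exterior_side :: "(real^2) set \<Rightarrow> real^2 \<Rightarrow> real^2 \<Rightarrow> (real^2) set" where
  "exterior_side C u z =
     {y. (z, y) \<in> odd_crossing C \<and> (z - y) \<bullet> u > 0 \<or>
         (z, y) \<in> - odd_crossing C \<and> (z - y) \<bullet> u < 0}"

definition interior_side :: "(real^2) set \<Rightarrow> real^2 \<Rightarrow> real^2 \<Rightarrow> (real^2) set" where
  "interior_side C u z =
     {y. (z, y) \<in> - odd_crossing C \<and> (z - y) \<bullet> u > 0 \<or>
         (z, y) \<in> odd_crossing C \<and> (z - y) \<bullet> u < 0}"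

definition chi_hat :: "(real^2) set \<Rightarrow> real^2 \<Rightarrow> real^2 \<Rightarrow> real^2 \<Rightarrow> real" where
  "chi_hat C u z y =
     (if y \<in> interior_side C u z then 1 else if y \<in> exterior_side C u z then - 1 else 0)"

definition curvature_kernel :: "real \<Rightarrow> real^2 \<Rightarrow> (real^2) set \<Rightarrow> real^2 \<Rightarrow> real^2 \<Rightarrow> real" where
  "curvature_kernel \<sigma> z C u y = chi_hat C u z y / norm (z - y) powr (2 + \<sigma>)"

definition truncated_curvature :: "real \<Rightarrow> real^2 \<Rightarrow> (real^2) set \<Rightarrow> real^2 \<Rightarrow> real \<Rightarrow> real" where
  "truncated_curvature \<sigma> z C u \<epsilon> =
     1 / 2 * (LINT y : - ball z \<epsilon> | lebesgue. curvature_kernel \<sigma> z C u y)"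

text \<open>
  \<open>curvature_on\<close> is meant for a point \<open>z\<close> of \<open>C\<close> near which \<open>C\<close> is \<open>C\<^sup>1\<close>, with \<open>u\<close> a unit
  normal to \<open>C\<close> at \<open>z\<close>. Since integrals and limits are total functions, existence is
  expressed by separate predicates.
\<close>

definition curvature_on_exists :: "real \<Rightarrow> real^2 \<Rightarrow> (real^2) set \<Rightarrow> real^2 \<Rightarrow> bool" where
  "curvature_on_exists \<sigma> z C u \<longleftrightarrow>
     (\<forall>\<epsilon>>0. set_integrable lebesgue (- ball z \<epsilon>) (curvature_kernel \<sigma> z C u)) \<and>
     (\<exists>k. (truncated_curvature \<sigma> z C u \<longlongrightarrow> k) (at_right 0))"

definition curvature_on :: "real \<Rightarrow> real^2 \<Rightarrow> (real^2) set \<Rightarrow> real^2 \<Rightarrow> real" where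
  "curvature_on \<sigma> z C u = Lim (at_right 0) (truncated_curvature \<sigma> z C u)"

definition rotate_clockwise :: "real^2 \<Rightarrow> real^2" where
  "rotate_clockwise u = vector [u $ 2, - u $ 1]"

definition add_segment :: "(real^2) set \<Rightarrow> real^2 \<Rightarrow> real^2 \<Rightarrow> real \<Rightarrow> (real^2) set" where
  "add_segment C z u \<delta> =
     C \<union> closed_segment (z - \<delta> *\<^sub>R rotate_clockwise u) (z + \<delta> *\<^sub>R rotate_clockwise u)"

definition nonlocal_curvature_exists :: "real \<Rightarrow> real^2 \<Rightarrow> (real^2) set \<Rightarrow> real^2 \<Rightarrow> bool" where
  "nonlocal_curvature_exists \<sigma> z C u \<longleftrightarrow>
     (if z \<in> C then curvature_on_exists \<sigma> z C u
      else (\<forall>\<^sub>F \<delta> in at_right 0. curvature_on_exists \<sigma> z (add_segment C z u \<delta>) u) \<and>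
           (\<exists>k. ((\<lambda>\<delta>. curvature_on \<sigma> z (add_segment C z u \<delta>) u) \<longlongrightarrow> k) (at_right 0)))"

definition nonlocal_curvature :: "real \<Rightarrow> real^2 \<Rightarrow> (real^2) set \<Rightarrow> real^2 \<Rightarrow> real" where
  "nonlocal_curvature \<sigma> z C u =
     (if z \<in> C then curvature_on \<sigma> z C u
      else Lim (at_right 0) (\<lambda>\<delta>. curvature_on \<sigma> z (add_segment C z u \<delta>) u))"

text \<open>
  Direction at angle \<open>\<theta>\<close> in the Cartesian frame whose \<open>x\<close>-axis points along \<open>e\<close> and whose
  \<open>y\<close>-axis points along \<open>u\<close>.
\<close>

definition frame_dir :: "real^2 \<Rightarrow> real^2 \<Rightarrow> real \<Rightarrow> real^2" where
  "frame_dir e u \<theta> = cos \<theta> *\<^sub>R e + sin \<theta> *\<^sub>R u"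

end

theory Submission
  imports Defs
begin

text \<open>
  Adding the small segment through \<open>z\<close> makes the plane split along the line through \<open>z\<close>
  orthogonal to \<open>u\<close>: on the side of \<open>u\<close> a point has sign \<open>1\<close> if \<open>L\<close> hides it from \<open>z\<close> and
  \<open>- 1\<close> otherwise, on the other side the sign is always \<open>1\<close>. Up to a null set the integrand is
  therefore a function odd under the reflection at \<open>z\<close>, which integrates to \<open>0\<close>, plus twice the
  kernel \<open>\<bar>y - z\<bar> powr - (2 + \<sigma>)\<close> on the shadow of \<open>L\<close>. In orthonormal coordinates \<open>(q, x)\<close> at \<open>z\<close>
  with \<open>L = {d} \<times> {a..b}\<close> the shadow is the cone \<open>q > d\<close>, \<open>x d / q \<in> {a..b}\<close>, and scaling every slice
  \<open>q = const\<close> back to \<open>q = d\<close> factors the integral as \<open>d / \<sigma>\<close> times the integral over \<open>{a..b}\<close> of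
  \<open>(d\<^sup>2 + x\<^sup>2) powr (- (2 + \<sigma>) / 2)\<close>. The substitution \<open>v = x\<^sup>2 / (d\<^sup>2 + x\<^sup>2) = sin\<^sup>2 (\<theta> - \<theta>p)\<close> turns the latter
  into incomplete beta functions.
\<close>

section \<open>Lebesgue measure in orthonormal coordinates\<close>

text \<open>Boxes determine Lebesgue measure, and the preimage of a box under \<open>T\<close> is
  its image under \<open>inv T\<close>, which is orthogonal too and so keeps the measure.\<close>

lemma distr_orthogonal_transformation_lborel:
  fixes T :: "real^'n::{finite,wellorder} \<Rightarrow> real^'n::{finite,wellorder}"
  assumes T: "orthogonal_transformation T"
  shows "distr lborel lborel T = lborel"
proof (rule lborel_eqI[symmetric])
  have lin: "linear T" and bij: "bij T"
    using T orthogonal_transformation_bij orthogonal_transformation_linear by blast+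
  have orth': "orthogonal_transformation (inv T)"
    using T by (simp add: orthogonal_transformation_inv)
  have meas: "T \<in> borel_measurable borel"
    using lin by (simp add: borel_measurable_continuous_onI linear_continuous_on linear_linear)
  fix l u :: "real^'n::{finite,wellorder}"
  assume le: "\<And>b. b \<in> Basis \<Longrightarrow> l \<bullet> b \<le> u \<bullet> b"
  have "emeasure (distr lborel lborel T) (box l u) = emeasure lborel (T -` box l u)"
    using meas by (subst emeasure_distr) auto
  also have "T -` box l u = inv T ` box l u"
    using bij by (simp add: bij_vimage_eq_inv_image)
  also have "emeasure lborel (inv T ` box l u) = emeasure lebesgue (inv T ` box l u)"
    using bij meas by (auto simp: bij_vimage_eq_inv_image[symmetric] measurable_sets_borel)
  also have "\<dots> = emeasure lebesgue (box l u)"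
  proof -
    have L: "box l u \<in> lmeasurable" by simp
    have "inv T ` box l u \<in> lmeasurable"
      using measurable_orthogonal_image[OF orth' L] .
    then show ?thesis
      using measure_orthogonal_image[OF orth' L] L
      by (simp add: emeasure_eq_measure2)
  qed
  also have "\<dots> = ennreal (\<Prod>b\<in>Basis. (u - l) \<bullet> b)"
    using le by simp
  finally show "emeasure (distr lborel lborel T) (box l u) = ennreal (\<Prod>b\<in>Basis. (u - l) \<bullet> b)" .
qed simp

lemma borel_measurable_vec2:
  "(\<lambda>(q, x). vector [q, x] :: real^2) \<in> borel_measurable borel"
proof (rule borel_measurable_continuous_onI)
  have eq: "(\<lambda>(q, x). vector [q, x] :: real^2) = (\<lambda>p. \<chi> i. if i = 1 then fst p else snd p)"
    by (auto simp: fun_eq_iff vec_eq_iff forall_2)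
  have "continuous_on UNIV (\<lambda>p. if i = 1 then fst p else snd p :: real)" for i :: 2
    by (cases "i = 1") (simp_all add: continuous_on_fst continuous_on_snd continuous_on_id)
  then show "continuous_on UNIV (\<lambda>(q, x). vector [q, x] :: real^2)"
    unfolding eq by (intro continuous_on_vec_lambda)
qed

text \<open>Identifying pairs with vectors lets Fubini on the product act on integrals over the
  plane.\<close>

lemma distr_vec2_lborel:
  "distr lborel lborel (\<lambda>(q, x). vector [q, x] :: real^2) = lborel"
proof (rule lborel_eqI[symmetric])
  have meas: "(\<lambda>(q, x). vector [q, x] :: real^2) \<in> borel_measurable borel"
    by (rule borel_measurable_vec2)
  fix l u :: "real^2"
  assume le: "\<And>b. b \<in> Basis \<Longrightarrow> l \<bullet> b \<le> u \<bullet> b"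
  have le': "l $ 1 \<le> u $ 1" "l $ 2 \<le> u $ 2"
    using le[of "axis 1 1"] le[of "axis 2 1"] by (auto simp: inner_axis)
  have "emeasure (distr lborel lborel (\<lambda>(q, x). vector [q, x])) (box l u)
      = emeasure lborel ((\<lambda>(q, x). vector [q, x]) -` box l u)"
    using meas by (subst emeasure_distr) auto
  also have "(\<lambda>(q, x). vector [q, x]) -` box l u = box (l $ 1, l $ 2) (u $ 1, u $ 2)"
    by (auto simp: box_def Basis_vec_def Basis_prod_def forall_2 inner_axis)
  also have "emeasure lborel \<dots> = ennreal ((u $ 1 - l $ 1) * (u $ 2 - l $ 2))"
    using le' by (subst emeasure_lborel_box) (auto simp: Basis_prod_def prod.union_disjoint prod.reindex inj_on_def)
  also have "\<dots> = ennreal (\<Prod>b\<in>Basis. (u - l) \<bullet> b)"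
    by (simp add: Basis_vec_def UNIV_2 inner_axis axis_eq_axis mult.commute)
  finally show "emeasure (distr lborel lborel (\<lambda>(q, x). vector [q, x])) (box l u)
    = ennreal (\<Prod>b\<in>Basis. (u - l) \<bullet> b)" .
qed simp

lemma real2_expand_orthonormal:
  fixes f g y :: "real^2"
  assumes "norm f = 1" "norm g = 1" "f \<bullet> g = 0"
  shows "y = (y \<bullet> f) *\<^sub>R f + (y \<bullet> g) *\<^sub>R g"
proof -
  have "pairwise orthogonal {f, g}"
    using assms by (auto simp: pairwise_def orthogonal_def inner_commute)
  moreover have "0 \<notin> {f, g}" using assms by auto
  ultimately have ind: "independent {f, g}"
    by (rule pairwise_orthogonal_independent)
  have "f \<noteq> g" using assms by (auto simp: norm_eq_1)
  then have "card {f, g} = DIM(real^2)" by simp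
  then have "y \<in> span {f, g}"
    using ind card_eq_dim[of "{f, g}" UNIV] by auto
  then obtain a b where y: "y = a *\<^sub>R f + b *\<^sub>R g"
    by (metis (no_types, lifting) span_insert span_breakdown_eq span_singleton diff_eq_eq add.commute rangeE)
  have "y \<bullet> f = a" "y \<bullet> g = b"
    using assms by (auto simp: y inner_add_left inner_add_right norm_eq_1 inner_commute)
  then show ?thesis using y by simp
qed

text \<open>Three measure-preserving maps in a row: a pair becomes a vector, an orthogonal map sends
  the standard basis to \<open>f\<close>, \<open>g\<close>, and a translation moves the origin to
  \<open>z\<close>.\<close>

lemma distr_orthonormal_frame_lborel:
  fixes f g z :: "real^2"
  assumes "norm f = 1" "norm g = 1" "f \<bullet> g = 0"
  shows "distr lborel lborel (\<lambda>(q, x). z + (q *\<^sub>R f + x *\<^sub>R g)) = lborel"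
proof -
  let ?V = "\<lambda>(q, x). vector [q, x] :: real^2"
  let ?T = "\<lambda>y::real^2. (y $ 1) *\<^sub>R f + (y $ 2) *\<^sub>R g"
  have lin: "linear ?T"
    by (intro linearI) (auto simp: algebra_simps)
  have "orthogonal_transformation ?T"
    unfolding orthogonal_transformation
  proof (intro conjI allI lin)
    fix v :: "real^2"
    have "(norm (?T v))\<^sup>2 = (v $ 1)\<^sup>2 * (f \<bullet> f) + (v $ 2)\<^sup>2 * (g \<bullet> g)"
      using assms(3) unfolding power2_norm_eq_inner
      by (simp add: inner_add_left inner_add_right inner_commute power2_eq_square)
    also have "\<dots> = (v $ 1)\<^sup>2 + (v $ 2)\<^sup>2"
      using assms(1,2) by (simp add: norm_eq_1)
    also have "\<dots> = (norm v)\<^sup>2"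
      unfolding power2_norm_eq_inner by (simp add: inner_vec_def sum_2 power2_eq_square)
    finally show "norm (?T v) = norm v" by (simp add: power2_eq_iff_nonneg)
  qed
  then have T: "distr lborel lborel ?T = lborel"
    by (rule distr_orthogonal_transformation_lborel)
  have mT: "?T \<in> borel_measurable borel"
    by measurable
  note mV = borel_measurable_vec2
  have "lborel = distr (distr (distr lborel lborel ?V) lborel ?T) borel ((+) z)"
    by (simp add: distr_vec2_lborel T lborel_distr_plus)
  also have "\<dots> = distr lborel borel ((+) z \<circ> (?T \<circ> ?V))"
    using mT mV by (subst distr_distr; simp)+
  also have "(+) z \<circ> (?T \<circ> ?V) = (\<lambda>(q, x). z + (q *\<^sub>R f + x *\<^sub>R g))"
    by (auto simp: fun_eq_iff)
  finally show ?thesis by (simp cong: distr_cong)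
qed

section \<open>The kernel integral over a shadow\<close>

text \<open>
  The points hidden from \<open>z\<close> by the segment that has the coordinates \<open>{d} \<times> {a..b}\<close> in the
  orthonormal frame \<open>f, g\<close> at \<open>z\<close>; written without division.
\<close>

definition shadow :: "real^2 \<Rightarrow> real^2 \<Rightarrow> real^2 \<Rightarrow> real \<Rightarrow> real \<Rightarrow> real \<Rightarrow> (real^2) set" where
  "shadow z f g d a b =
    {y. d < (y - z) \<bullet> f \<and> a * ((y - z) \<bullet> f) \<le> d * ((y - z) \<bullet> g) \<and> d * ((y - z) \<bullet> g) \<le> b * ((y - z) \<bullet> f)}"

lemma shadow_measurable [measurable]: "shadow z f g d a b \<in> sets borel"
  unfolding shadow_def by measurable

text \<open>The exponent is what scaling the slices leaves over. As \<open>\<sigma> > 0\<close>, the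
  primitive vanishes at infinity, and the value comes from the end \<open>q = d\<close>.\<close>

lemma nn_integral_powr_ray:
  fixes d \<sigma> :: real
  assumes "0 < d" "0 < \<sigma>"
  shows "(\<integral>\<^sup>+ q. ennreal ((q / d) powr (- 1 - \<sigma>)) * indicator {d..} q \<partial>lborel) = ennreal (d / \<sigma>)"
proof -
  have "(\<integral>\<^sup>+ q. ennreal ((q / d) powr (- 1 - \<sigma>)) * indicator {d..} q \<partial>lborel)
      = ennreal (0 - (- (d / \<sigma>) * (d / d) powr (- \<sigma>)))"
  proof (rule nn_integral_FTC_atLeast[where F = "\<lambda>q. - (d / \<sigma>) * (q / d) powr (- \<sigma>)"])
    show "((\<lambda>q. - (d / \<sigma>) * (q / d) powr (- \<sigma>)) \<longlongrightarrow> 0) at_top"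
    proof -
      have "((\<lambda>q. (q / d) powr (- \<sigma>)) \<longlongrightarrow> 0) at_top"
      proof (rule tendsto_neg_powr)
        show "LIM q at_top. q / d :> at_top"
          using assms by (simp add: divide_inverse filterlim_at_top_mult_tendsto_pos[OF tendsto_const _ filterlim_ident])
      qed (use assms in auto)
      from tendsto_mult_right_zero[OF this] show ?thesis .
    qed
    fix q assume "d \<le> q"
    then have "q / d > 0" using assms by simp
    then show "((\<lambda>q. - (d / \<sigma>) * (q / d) powr (- \<sigma>)) has_real_derivative (q / d) powr (- 1 - \<sigma>)) (at q)"
      using assms by (auto intro!: derivative_eq_intros simp: powr_diff powr_minus field_simps)
  qed auto
  with assms show ?thesis by simp
qed

lemma powr_half_power2:
  fixes x :: real
  assumes "0 < x"
  shows "(x\<^sup>2) powr (c / 2) = x powr c"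
proof -
  have "x\<^sup>2 = x powr 2" using assms by (simp add: powr_numeral)
  then show ?thesis by (simp add: powr_powr)
qed

text \<open>Multiplication by \<open>q / d\<close> maps \<open>{a..b}\<close> onto the slice. The
  kernel is homogeneous of degree \<open>- (2 + \<sigma>)\<close> and the Jacobian adds one power of
  \<open>q / d\<close>.\<close>

lemma nn_integral_shadow_slice:
  fixes a b d q \<sigma> :: real
  assumes "0 < d" "d < q" "a \<le> b"
  shows "(\<integral>\<^sup>+ x. ennreal ((q\<^sup>2 + x\<^sup>2) powr (- (2 + \<sigma>) / 2)) * indicator {x. a * q \<le> d * x \<and> d * x \<le> b * q} x \<partial>lborel)
    = ennreal ((q / d) powr (- 1 - \<sigma>)) * ennreal (integral {a..b} (\<lambda>x. (d\<^sup>2 + x\<^sup>2) powr (- (2 + \<sigma>) / 2)))"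
    (is "?L = _")
proof -
  let ?k = "\<lambda>x. (d\<^sup>2 + x\<^sup>2) powr (- (2 + \<sigma>) / 2)"
  have q: "q > 0" "q / d > 0" using assms by auto
  have "continuous_on {a..b} ?k"
    using assms by (auto intro!: continuous_intros)
  then have K: "(?k has_integral integral {a..b} ?k) {a..b}"
    by (intro integrable_integral integrable_continuous_real)
  \<comment> \<open>The summand 0 is the shift of the affine substitution below, kept so that this
    equation matches its result literally.\<close>
  have eq: "ennreal ((q\<^sup>2 + (0 + q / d * x)\<^sup>2) powr (- (2 + \<sigma>) / 2)) *
      indicator {x. a * q \<le> d * x \<and> d * x \<le> b * q} (0 + q / d * x)
    = ennreal ((q / d) powr (- (2 + \<sigma>))) * (ennreal (?k x) * indicator {a..b} x)" for x
  proof -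
    have "q\<^sup>2 + (q / d * x)\<^sup>2 = (q / d)\<^sup>2 * (d\<^sup>2 + x\<^sup>2)"
      using assms by (simp add: field_simps)
    then have "(q\<^sup>2 + (q / d * x)\<^sup>2) powr (- (2 + \<sigma>) / 2)
        = ((q / d)\<^sup>2) powr (- (2 + \<sigma>) / 2) * ?k x"
      by (simp add: powr_mult)
    also have "((q / d)\<^sup>2) powr (- (2 + \<sigma>) / 2) = (q / d) powr (- (2 + \<sigma>))"
      using q(2) by (rule powr_half_power2)
    finally have "(q\<^sup>2 + (q / d * x)\<^sup>2) powr (- (2 + \<sigma>) / 2) = (q / d) powr (- (2 + \<sigma>)) * ?k x" .
    moreover have "a * q \<le> d * (q / d * x) \<longleftrightarrow> a \<le> x" "d * (q / d * x) \<le> b * q \<longleftrightarrow> x \<le> b"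
      using assms q by (auto simp: mult.commute)
    ultimately show ?thesis
      by (simp add: indicator_def ennreal_mult')
  qed
  have "?L = ennreal \<bar>q / d\<bar> * (\<integral>\<^sup>+ x. ennreal ((q / d) powr (- (2 + \<sigma>))) * (ennreal (?k x) * indicator {a..b} x) \<partial>lborel)"
    using q by (subst nn_integral_real_affine[where c = "q / d" and t = 0]) (simp_all only: eq, auto)
  also have "\<dots> = ennreal \<bar>q / d\<bar> * (ennreal ((q / d) powr (- (2 + \<sigma>))) * (\<integral>\<^sup>+ x. ennreal (?k x) * indicator {a..b} x \<partial>lborel))"
    by (subst nn_integral_cmult) auto
  also have "(\<integral>\<^sup>+ x. ennreal (?k x) * indicator {a..b} x \<partial>lborel) = ennreal (integral {a..b} ?k)"
    using K by (intro nn_integral_has_integral_lebesgue') auto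
  also have "ennreal \<bar>q / d\<bar> * (ennreal ((q / d) powr (- (2 + \<sigma>))) * \<dots>)
      = ennreal (q / d * (q / d) powr (- (2 + \<sigma>))) * ennreal (integral {a..b} ?k)"
    using q(2) by (simp only: ennreal_mult' less_imp_le mult.assoc abs_of_pos)
  also have "q / d * (q / d) powr (- (2 + \<sigma>)) = (q / d) powr (- 1 - \<sigma>)"
    using powr_mult_base[of "q / d" "- (2 + \<sigma>)"] q by simp
  finally show ?thesis .
qed

lemma norm_orthonormal_combination:
  fixes f g :: "'a::real_inner"
  assumes "norm f = 1" "norm g = 1" "f \<bullet> g = 0"
  shows "norm (q *\<^sub>R f + x *\<^sub>R g) = sqrt (q\<^sup>2 + x\<^sup>2)"
  using assms unfolding norm_eq_sqrt_inner
  by (simp add: inner_add_left inner_add_right inner_commute norm_eq_1 power2_eq_square)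

lemma nn_integral_shadow:
  fixes f g z :: "real^2"
  assumes fg: "norm f = 1" "norm g = 1" "f \<bullet> g = 0"
    and "0 < d" "a \<le> b" "0 < \<sigma>"
  shows "(\<integral>\<^sup>+ y. ennreal (1 / norm (z - y) powr (2 + \<sigma>)) * indicator (shadow z f g d a b) y \<partial>lborel)
    = ennreal (d / \<sigma> * integral {a..b} (\<lambda>x. (d\<^sup>2 + x\<^sup>2) powr (- (2 + \<sigma>) / 2)))"
proof -
  let ?T = "\<lambda>(q, x). z + (q *\<^sub>R f + x *\<^sub>R g)"
  let ?h = "\<lambda>y. ennreal (1 / norm (z - y) powr (2 + \<sigma>)) * indicator (shadow z f g d a b) y"
  let ?K = "integral {a..b} (\<lambda>x. (d\<^sup>2 + x\<^sup>2) powr (- (2 + \<sigma>) / 2))"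
  have mT: "?T \<in> borel_measurable borel" 
    by (intro borel_measurable_continuous_onI) (auto simp: case_prod_unfold intro!: continuous_intros)
  have mh: "?h \<in> borel_measurable borel"
    by measurable
  have pt: "?h (?T (q, x)) = (if d < q then ennreal ((q\<^sup>2 + x\<^sup>2) powr (- (2 + \<sigma>) / 2))
      * indicator {x. a * q \<le> d * x \<and> d * x \<le> b * q} x else 0)" for q x
  proof -
    have n: "norm (z - ?T (q, x)) = sqrt (q\<^sup>2 + x\<^sup>2)"
    proof -
      have "z - ?T (q, x) = - (q *\<^sub>R f + x *\<^sub>R g)" by simp
      then show ?thesis by (metis norm_minus_cancel norm_orthonormal_combination[OF fg])
    qed
    have i: "(q *\<^sub>R f + x *\<^sub>R g) \<bullet> f = q" "(q *\<^sub>R f + x *\<^sub>R g) \<bullet> g = x"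
      using fg by (simp_all add: inner_add_left inner_add_right norm_eq_1 inner_commute)
    have "1 / sqrt (q\<^sup>2 + x\<^sup>2) powr (2 + \<sigma>) = (q\<^sup>2 + x\<^sup>2) powr (- ((2 + \<sigma>) / 2))"
      by (simp only: powr_minus_divide) (simp add: powr_half_sqrt[symmetric] powr_powr)
    then have "1 / sqrt (q\<^sup>2 + x\<^sup>2) powr (2 + \<sigma>) = (q\<^sup>2 + x\<^sup>2) powr (- (2 + \<sigma>) / 2)"
      by (simp only: minus_divide_left)
    then show ?thesis
      unfolding n by (simp add: shadow_def i indicator_def)
  qed
  have "(\<integral>\<^sup>+ y. ?h y \<partial>lborel) = (\<integral>\<^sup>+ p. ?h (?T p) \<partial>lborel)"
    using mT mh by (subst distr_orthonormal_frame_lborel[OF fg, of z, symmetric], subst nn_integral_distr) auto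
  also have "\<dots> = (\<integral>\<^sup>+ q. \<integral>\<^sup>+ x. ?h (?T (q, x)) \<partial>lborel \<partial>lborel)"
    using mT mh by (subst lborel_prod[symmetric], subst lborel.nn_integral_fst[symmetric])
      (auto simp: lborel_prod intro: measurable_compose[OF mT mh])
  also have "\<dots> = (\<integral>\<^sup>+ q. ennreal ?K * (ennreal ((q / d) powr (- 1 - \<sigma>)) * indicator {d..} q) \<partial>lborel)"
  proof (rule nn_integral_cong_AE)
    \<comment> \<open>The slice \<open>q = d\<close> is outside the shadow but inside
      \<open>{d..}\<close>; a single point has measure zero.\<close>
    have "AE q in lborel. q \<noteq> d" by (rule AE_lborel_singleton)
    then show "AE q in lborel. (\<integral>\<^sup>+ x. ?h (?T (q, x)) \<partial>lborel)
        = ennreal ?K * (ennreal ((q / d) powr (- 1 - \<sigma>)) * indicator {d..} q)"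
    proof eventually_elim
      case (elim q)
      then show ?case
        unfolding pt using assms nn_integral_shadow_slice[of d q a b \<sigma>]
        by (cases "d < q") (auto simp: mult.commute)
    qed
  qed
  also have "\<dots> = ennreal ?K * ennreal (d / \<sigma>)"
    using assms by (subst nn_integral_cmult) (auto simp: nn_integral_powr_ray)
  also have "\<dots> = ennreal (d / \<sigma> * ?K)"
    using assms by (simp add: ennreal_mult'[symmetric] mult.commute)
  finally show ?thesis .
qed

section \<open>The slice integral as a difference of beta functions\<close>

text \<open>Since \<open>d > 0\<close>, the integrand is continuous on the whole line. Only
  differences of values of \<open>F\<close> enter later, so an abstract primitive serves.\<close>

lemma kernel_primitive_exists:
  fixes c d :: real
  assumes "0 < d"
  obtains F where "\<And>x. (F has_real_derivative (d\<^sup>2 + x\<^sup>2) powr c) (at x)"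
proof -
  have "isCont (\<lambda>x. (d\<^sup>2 + x\<^sup>2) powr c) x" for x :: real
    using assms by (auto intro!: continuous_intros)
  then have "\<exists>F. \<forall>x::real. -\<infinity> < ereal x \<longrightarrow> ereal x < \<infinity> \<longrightarrow>
      (F has_vector_derivative (d\<^sup>2 + x\<^sup>2) powr c) (at x)"
    by (intro einterval_antiderivative) auto
  then show ?thesis
    using that by (auto simp: has_real_derivative_iff_has_vector_derivative)
qed

lemma Psi_minus: "Psi \<sigma> (- t) = - Psi \<sigma> t"
  by (simp add: Psi_def sgn_minus)

text \<open>The beta variable depends on \<open>x\<^sup>2\<close> alone, so the substitution is
  inverted on one half-line first. It turns the beta integral into
  \<open>2 * d powr (\<sigma> + 1)\<close> times the kernel integral, and the 2 cancels the 1/2 in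
  \<open>Psi\<close>.\<close>

lemma Psi_primitive_nonneg:
  fixes d \<sigma> x :: real
  assumes d: "0 < d" and x: "0 \<le> x"
    and F: "\<And>x. (F has_real_derivative (d\<^sup>2 + x\<^sup>2) powr (- (2 + \<sigma>) / 2)) (at x)"
  shows "Psi \<sigma> (x / sqrt (d\<^sup>2 + x\<^sup>2)) = d powr (\<sigma> + 1) * (F x - F 0)"
proof (cases "x = 0")
  case True
  then show ?thesis by (simp add: Psi_def)
next
  case False
  define T where "T = x\<^sup>2 / (d\<^sup>2 + x\<^sup>2)"
  have pos: "d\<^sup>2 + x\<^sup>2 > 0" using d by (simp add: pos_add_strict add_pos_nonneg)
  have T: "0 \<le> T" "T < 1" using d pos by (auto simp: T_def)
  \<comment> \<open>\<open>?w\<close> inverts \<open>v = x\<^sup>2 / (d\<^sup>2 + x\<^sup>2)\<close>; the integrand is singular at \<open>0\<close>, so only the interior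
    form of the fundamental theorem applies.\<close>
  let ?w = "\<lambda>v. d * sqrt (v / (1 - v))"
  have "((\<lambda>v. v powr (1 / 2 - 1) * (1 - v) powr ((1 + \<sigma>) / 2 - 1)) has_integral
      2 * d powr (\<sigma> + 1) * F (?w T) - 2 * d powr (\<sigma> + 1) * F (?w 0)) {0..T}"
  proof (rule fundamental_theorem_of_calculus_interior)
    have contF: "continuous_on UNIV F"
      using F by (meson DERIV_isCont continuous_at_imp_continuous_on)
    show "continuous_on {0..T} (\<lambda>v. 2 * d powr (\<sigma> + 1) * F (?w v))"
      using T by (intro continuous_intros continuous_on_compose2[OF contF]) auto
    fix v assume v: "v \<in> {0<..<T}"
    then have v01: "0 < v" "v < 1" using T by auto
    \<comment> \<open>With \<open>v\<close> a squared sine, \<open>s\<close> and \<open>r\<close>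
      are the sine and cosine, \<open>?w v = d * s / r\<close>, and every factor becomes a real
      power of \<open>d\<close>, \<open>s\<close> or \<open>r\<close>.\<close>
    define s where "s = sqrt v"
    define r where "r = sqrt (1 - v)"
    have sr: "s > 0" "r > 0" "v = s\<^sup>2" "1 - v = r\<^sup>2" using v01 by (auto simp: s_def r_def)
    have dw: "(?w has_real_derivative d / (2 * s * r ^ 3)) (at v)"
    proof -
      have "(?w has_real_derivative d * (((1 - v) + v) / (1 - v)\<^sup>2 * (inverse (sqrt (v / (1 - v))) / 2))) (at v)"
        using v01 by (auto intro!: derivative_eq_intros simp: power2_eq_square field_simps)
      also have "d * (((1 - v) + v) / (1 - v)\<^sup>2 * (inverse (sqrt (v / (1 - v))) / 2)) = d / (2 * s * r ^ 3)"
        using sr by (simp add: real_sqrt_divide s_def[symmetric] r_def[symmetric])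
          (simp add: field_simps power2_eq_square power3_eq_cube power4_eq_xxxx)
      finally show ?thesis .
    qed
    have base: "d\<^sup>2 + (?w v)\<^sup>2 = (d / r)\<^sup>2"
    proof -
      have w: "?w v = d * s / r"
        by (simp add: real_sqrt_divide s_def r_def)
      have "d\<^sup>2 + (?w v)\<^sup>2 = d\<^sup>2 * (r\<^sup>2 + s\<^sup>2) / r\<^sup>2"
        unfolding w using sr(1,2) by (simp add: field_simps)
      also have "r\<^sup>2 + s\<^sup>2 = 1" using sr by simp
      finally show ?thesis by (simp add: power_divide)
    qed
    have "(d\<^sup>2 + (?w v)\<^sup>2) powr (- (2 + \<sigma>) / 2) = (d / r) powr (- (2 + \<sigma>))"
      unfolding base using sr d by (intro powr_half_power2) simp
    also have "\<dots> = d powr (- (2 + \<sigma>)) * r powr (2 + \<sigma>)"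
      using sr d by (simp only: powr_divide powr_minus_divide[of r]) simp
    finally have kv: "(d\<^sup>2 + (?w v)\<^sup>2) powr (- (2 + \<sigma>) / 2) = d powr (- (2 + \<sigma>)) * r powr (2 + \<sigma>)" .
    have "((\<lambda>v. 2 * d powr (\<sigma> + 1) * F (?w v)) has_real_derivative
        2 * d powr (\<sigma> + 1) * ((d\<^sup>2 + (?w v)\<^sup>2) powr (- (2 + \<sigma>) / 2) * (d / (2 * s * r ^ 3)))) (at v)"
      by (rule DERIV_cmult[OF DERIV_chain2[OF F dw]])
    \<comment> \<open>The powers of \<open>d\<close> cancel, those of \<open>r\<close> add up to
      \<open>\<sigma> - 1\<close>, and that of \<open>s\<close> is -1; as powers of
      \<open>1 - v\<close> and \<open>v\<close> these are the beta exponents.\<close>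
    also have "2 * d powr (\<sigma> + 1) * ((d\<^sup>2 + (?w v)\<^sup>2) powr (- (2 + \<sigma>) / 2) * (d / (2 * s * r ^ 3)))
        = (d powr (\<sigma> + 1) * d powr (- (2 + \<sigma>)) * d powr 1) * (r powr (2 + \<sigma>) * r powr (- 3)) * s powr (- 1)"
      unfolding kv using sr d
      by (simp add: powr_minus_divide powr_numeral mult_ac)
    also have "d powr (\<sigma> + 1) * d powr (- (2 + \<sigma>)) * d powr 1 = 1"
      using d by (simp add: powr_add[symmetric])
    also have "r powr (2 + \<sigma>) * r powr (- 3) = (r powr 2) powr ((1 + \<sigma>) / 2 - 1)"
      unfolding powr_powr powr_add[symmetric]
      by (rule arg_cong[where f = "(powr) r"]) (simp add: field_simps)
    also have "s powr (- 1) = (s powr 2) powr (1 / 2 - 1)"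
      unfolding powr_powr by simp
    finally show "((\<lambda>v. 2 * d powr (\<sigma> + 1) * F (?w v)) has_vector_derivative
        v powr (1 / 2 - 1) * (1 - v) powr ((1 + \<sigma>) / 2 - 1)) (at v)"
      using sr by (simp add: has_real_derivative_iff_has_vector_derivative powr_numeral mult.commute)
  qed (use T in auto)
  moreover have "?w T = x"
  proof -
    have "1 - T = d\<^sup>2 / (d\<^sup>2 + x\<^sup>2)" using pos unfolding T_def
      by (metis (no_types) add_diff_cancel_right' diff_divide_distrib divide_self less_irrefl)
    then have "T / (1 - T) = (x / d)\<^sup>2" using pos by (simp add: T_def power_divide)
    then show ?thesis using d x by (simp add: real_sqrt_divide)
  qed
  ultimately have "incomplete_beta T (1 / 2) ((1 + \<sigma>) / 2) = 2 * d powr (\<sigma> + 1) * (F x - F 0)"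
    unfolding incomplete_beta_def by (simp add: integral_unique right_diff_distrib)
  moreover have "(x / sqrt (d\<^sup>2 + x\<^sup>2))\<^sup>2 = T"
    using pos by (simp add: T_def power_divide)
  moreover have "sgn (x / sqrt (d\<^sup>2 + x\<^sup>2)) = 1"
    using False x pos by (simp add: sgn_1_pos)
  ultimately show ?thesis by (simp add: Psi_def)
qed

text \<open>The kernel is even, so \<open>\<lambda>x. - F (- x)\<close> is another primitive. For
  negative \<open>x\<close> the previous case applies to it at \<open>- x\<close>, and
  \<open>Psi\<close> is odd.\<close>

lemma Psi_primitive:
  fixes d \<sigma> x :: real
  assumes d: "0 < d"
    and F: "\<And>x. (F has_real_derivative (d\<^sup>2 + x\<^sup>2) powr (- (2 + \<sigma>) / 2)) (at x)"
  shows "Psi \<sigma> (x / sqrt (d\<^sup>2 + x\<^sup>2)) = d powr (\<sigma> + 1) * (F x - F 0)"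
proof (cases "0 \<le> x")
  case True
  then show ?thesis using Psi_primitive_nonneg[OF d _ F] by simp
next
  case False
  have "((\<lambda>x. - F (- x)) has_real_derivative (d\<^sup>2 + x\<^sup>2) powr (- (2 + \<sigma>) / 2)) (at x)" for x
    using DERIV_minus[OF DERIV_chain2[OF F DERIV_minus[OF DERIV_ident]], of x] by simp
  from Psi_primitive_nonneg[OF d _ this, of "- x"] False
  show ?thesis by (simp add: Psi_minus algebra_simps)
qed

lemma integral_kernel_eq_Psi:
  fixes a b d \<sigma> :: real
  assumes d: "0 < d" and ab: "a \<le> b"
  shows "integral {a..b} (\<lambda>x. (d\<^sup>2 + x\<^sup>2) powr (- (2 + \<sigma>) / 2))
    = d powr (- \<sigma> - 1) * (Psi \<sigma> (b / sqrt (d\<^sup>2 + b\<^sup>2)) - Psi \<sigma> (a / sqrt (d\<^sup>2 + a\<^sup>2)))"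
proof -
  obtain F where F: "\<And>x. (F has_real_derivative (d\<^sup>2 + x\<^sup>2) powr (- (2 + \<sigma>) / 2)) (at x)"
    using kernel_primitive_exists[OF d] by metis
  have "((\<lambda>x. (d\<^sup>2 + x\<^sup>2) powr (- (2 + \<sigma>) / 2)) has_integral F b - F a) {a..b}"
    using F ab by (intro fundamental_theorem_of_calculus)
      (auto simp: has_real_derivative_iff_has_vector_derivative[symmetric] intro: has_field_derivative_at_within)
  then show ?thesis
    using d by (simp add: integral_unique Psi_primitive[OF d F] right_diff_distrib[symmetric]
      mult.assoc[symmetric] powr_add[symmetric])
qed

section \<open>Which points the segment hides from \<open>z\<close>\<close>

lemma mem_closed_segment_frame:
  fixes f g y z :: "real^2"
  assumes fg: "norm f = 1" "norm g = 1" "f \<bullet> g = 0" and "a \<le> b"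
  shows "y \<in> closed_segment (z + (d *\<^sub>R f + a *\<^sub>R g)) (z + (d *\<^sub>R f + b *\<^sub>R g))
    \<longleftrightarrow> (y - z) \<bullet> f = d \<and> a \<le> (y - z) \<bullet> g \<and> (y - z) \<bullet> g \<le> b"
proof -
  define w where "w = z + d *\<^sub>R f"
  have "closed_segment (z + (d *\<^sub>R f + a *\<^sub>R g)) (z + (d *\<^sub>R f + b *\<^sub>R g))
      = (\<lambda>t. w + t *\<^sub>R g) ` closed_segment a b"
    unfolding w_def using closed_segment_translation[of "z + d *\<^sub>R f" "a *\<^sub>R g" "b *\<^sub>R g"]
      closed_segment_linear_image[of "\<lambda>t. t *\<^sub>R g" a b]
    by (simp add: add.assoc image_image linear_scaleR_left)
  moreover have "(\<exists>t. a \<le> t \<and> t \<le> b \<and> y = w + t *\<^sub>R g)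
      \<longleftrightarrow> (y - z) \<bullet> f = d \<and> a \<le> (y - z) \<bullet> g \<and> (y - z) \<bullet> g \<le> b"
  proof
    assume "\<exists>t. a \<le> t \<and> t \<le> b \<and> y = w + t *\<^sub>R g"
    then show "(y - z) \<bullet> f = d \<and> a \<le> (y - z) \<bullet> g \<and> (y - z) \<bullet> g \<le> b"
      using fg by (auto simp: w_def inner_add_left inner_add_right norm_eq_1 inner_commute)
  next
    assume r: "(y - z) \<bullet> f = d \<and> a \<le> (y - z) \<bullet> g \<and> (y - z) \<bullet> g \<le> b"
    have "y - z = d *\<^sub>R f + ((y - z) \<bullet> g) *\<^sub>R g"
      using real2_expand_orthonormal[OF fg, of "y - z"] r by simp
    then have "y = w + ((y - z) \<bullet> g) *\<^sub>R g" by (simp add: w_def algebra_simps)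
    with r show "\<exists>t. a \<le> t \<and> t \<le> b \<and> y = w + t *\<^sub>R g" by blast
  qed
  ultimately show ?thesis
    using \<open>a \<le> b\<close> by (auto simp: closed_segment_eq_real_ivl)
qed

text \<open>For a short time an arc starting at \<open>p\<close> avoids the closed set
  \<open>S\<close>, hence runs in \<open>L\<close>, where the inner product with \<open>f\<close> is
  constant; its one-sided derivative at 0 vanishes.\<close>

lemma tangent_vector_orthogonal:
  assumes tv: "tangent_vector (L \<union> S) p v" and S: "closed S" "p \<notin> S"
    and L: "\<And>y. y \<in> L \<Longrightarrow> y \<bullet> f = c"
  shows "v \<bullet> f = 0"
proof -
  obtain \<gamma> where sub: "\<gamma> ` {0..1} \<subseteq> L \<union> S" and p: "\<gamma> 0 = p"
    and der: "(\<gamma> has_vector_derivative v) (at 0)"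
    using tv unfolding tangent_vector_def by blast
  have "isCont \<gamma> 0"
    using der by (rule has_vector_derivative_continuous)
  then have "\<forall>\<^sub>F t in at 0. \<gamma> t \<in> - S"
    using S p unfolding isCont_def by (intro topological_tendstoD) auto
  then obtain \<eta> where \<eta>: "\<eta> > 0" "\<And>t. t \<noteq> 0 \<Longrightarrow> \<bar>t\<bar> < \<eta> \<Longrightarrow> \<gamma> t \<notin> S"
    by (auto simp: eventually_at dist_real_def)
  \<comment> \<open>Capped by 1 because only the values on \<open>{0..1}\<close> lie in the curve,
    and halved to stay strictly below \<open>\<eta>\<close>.\<close>
  define \<rho> where "\<rho> = min 1 (\<eta> / 2)"
  have \<rho>: "0 < \<rho>" "\<rho> \<le> 1" "\<rho> < \<eta>" using \<eta> by (auto simp: \<rho>_def)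
  have const: "\<gamma> t \<bullet> f = c" if "t \<in> {0..\<rho>}" for t
  proof -
    have "\<gamma> t \<notin> S" using that \<eta>(2)[of t] S p \<rho> by (cases "t = 0") auto
    moreover have "\<gamma> t \<in> \<gamma> ` {0..1}" using that \<rho> by (intro imageI) auto
    ultimately show ?thesis using sub L by blast
  qed
  have "((\<lambda>t. \<gamma> t \<bullet> f) has_vector_derivative v \<bullet> f) (at 0)"
    using der by (rule bounded_linear.has_vector_derivative[OF bounded_linear_inner_left])
  then have "((\<lambda>t. \<gamma> t \<bullet> f) has_vector_derivative v \<bullet> f) (at 0 within {0..\<rho>})"
    by (rule has_vector_derivative_at_within)
  then have "((\<lambda>t. c) has_vector_derivative v \<bullet> f) (at 0 within {0..\<rho>})"
    by (rule has_vector_derivative_transform[rotated 2]) (use const \<rho> in auto)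
  then show ?thesis
    using vector_derivative_unique_within[of 0 "{0..\<rho>}" "\<lambda>t. c" "v \<bullet> f" 0] \<rho>
    by (simp add: trivial_limit_within islimpt_Icc)
qed

lemma mem_open_segment_ray:
  fixes z y p :: "'a::real_vector"
  shows "p \<in> open_segment z y \<longleftrightarrow> y \<noteq> z \<and> (\<exists>t. 0 < t \<and> t < 1 \<and> p = z + t *\<^sub>R (y - z))"
  by (auto simp: in_segment algebra_simps)

text \<open>
  \<open>S\<close> stands for the segment through \<open>z\<close> that the definition of the curvature adds to \<open>L\<close>. It lies
  on the line where the sign function vanishes, so its length is irrelevant.
\<close>

locale segment_frame =
  fixes z u f g :: "real^2" and a b d :: real and L S :: "(real^2) set"
  assumes fg: "norm f = 1" "norm g = 1" "f \<bullet> g = 0"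
    and d: "0 < d" and ab: "a \<le> b"
    and L: "L = closed_segment (z + (d *\<^sub>R f + a *\<^sub>R g)) (z + (d *\<^sub>R f + b *\<^sub>R g))"
    and above: "\<And>p. p \<in> L \<Longrightarrow> 0 \<le> (p - z) \<bullet> u"
    and S: "closed S" "\<And>p. p \<in> S \<Longrightarrow> (p - z) \<bullet> u = 0"
begin

lemma mem_L: "y \<in> L \<longleftrightarrow> (y - z) \<bullet> f = d \<and> a \<le> (y - z) \<bullet> g \<and> (y - z) \<bullet> g \<le> b"
  unfolding L by (rule mem_closed_segment_frame[OF fg ab])

text \<open>The ray from \<open>z\<close> towards \<open>y\<close> can reach level \<open>d\<close>
  along \<open>f\<close> only at the parameter \<open>t = d / ?q\<close>. Then \<open>t < 1\<close>
  reads \<open>d < ?q\<close>, and clearing the denominator in the bounds \<open>a\<close>,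
  \<open>b\<close> yields the other inequalities of \<open>shadow\<close>.\<close>

lemma L_Int_open_segment:
  "L \<inter> open_segment z y =
    (if y \<in> shadow z f g d a b then {z + (d / ((y - z) \<bullet> f)) *\<^sub>R (y - z)} else {})"
proof -
  let ?q = "(y - z) \<bullet> f" and ?x = "(y - z) \<bullet> g"
  have "p \<in> L \<inter> open_segment z y \<longleftrightarrow>
    y \<in> shadow z f g d a b \<and> p = z + (d / ?q) *\<^sub>R (y - z)" (is "?l \<longleftrightarrow> ?r") for p
  proof
    assume ?l
    then obtain t where t: "0 < t" "t < 1" "p = z + t *\<^sub>R (y - z)" and p: "p \<in> L"
      by (auto simp: mem_open_segment_ray)
    have *: "t * ?q = d" "a \<le> t * ?x" "t * ?x \<le> b"
      using p unfolding mem_L t(3) by simp_all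
    have q: "0 < ?q" using *(1) t(1) d zero_less_mult_pos by metis
    have "d < ?q" using mult_strict_right_mono[OF t(2) q] *(1) by simp
    moreover have "t = d / ?q" using *(1) q by (simp add: field_simps)
    moreover have "d * ?x = t * ?x * ?q"
      unfolding *(1)[symmetric] by (simp add: mult_ac)
    then have "a * ?q \<le> d * ?x" "d * ?x \<le> b * ?q"
      using mult_right_mono[OF *(2), of ?q] mult_right_mono[OF *(3), of ?q] q by (metis less_imp_le)+
    ultimately show ?r using t(3) by (simp add: shadow_def)
  next
    assume r: ?r
    then have q: "d < ?q" "0 < ?q" and x: "a * ?q \<le> d * ?x" "d * ?x \<le> b * ?q"
      using d by (auto simp: shadow_def)
    have pz: "p - z = (d / ?q) *\<^sub>R (y - z)" using r by simp
    have "p \<in> L"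
      unfolding mem_L pz inner_scaleR_left using q x by (simp add: field_simps)
    moreover have "y \<noteq> z" using q by auto
    ultimately show ?l
      using r q d by (auto simp: mem_open_segment_ray intro!: exI[of _ "d / ?q"])
  qed
  then show ?thesis by auto
qed

lemma shadow_above: "y \<in> shadow z f g d a b \<Longrightarrow> 0 \<le> (y - z) \<bullet> u"
proof -
  assume y: "y \<in> shadow z f g d a b"
  then have "z + (d / ((y - z) \<bullet> f)) *\<^sub>R (y - z) \<in> L"
    using L_Int_open_segment[of y] by auto
  from above[OF this] have "0 \<le> d / ((y - z) \<bullet> f) * ((y - z) \<bullet> u)" by simp
  moreover have "0 < d / ((y - z) \<bullet> f)" using y d by (auto simp: shadow_def)
  ultimately show ?thesis by (metis mult_neg_pos mult.commute not_le)
qed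

text \<open>As \<open>y\<close> is off the line containing \<open>S\<close>, the open segment avoids
  \<open>S\<close> and meets \<open>L\<close> at most once, so odd means once. Tangents at a
  crossing are orthogonal to \<open>f\<close>, but \<open>y - z\<close> is not, because it leads
  from level 0 to level \<open>d > 0\<close>; this gives transversality.\<close>

lemma odd_crossing_iff_shadow:
  assumes y: "(y - z) \<bullet> u \<noteq> 0"
  shows "(z, y) \<in> odd_crossing (L \<union> S) \<longleftrightarrow> y \<in> shadow z f g d a b"
proof -
  have noS: "p \<notin> S" if "p \<in> open_segment z y" for p
    using that S(2)[of p] y by (auto simp: mem_open_segment_ray)
  then have int: "(L \<union> S) \<inter> open_segment z y = L \<inter> open_segment z y" by blast
  have "transversal z y (L \<union> S)"
    unfolding transversal_def
  proof (intro ballI allI impI notI)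
    fix p v
    assume p: "p \<in> open_segment z y \<inter> (L \<union> S)" and tv: "tangent_vector (L \<union> S) p v"
      and v: "v \<in> span {y - z}"
    have pL: "p \<in> L" "p \<notin> S" using p noS by auto
    have "v \<bullet> f = 0"
      by (rule tangent_vector_orthogonal[OF tv S(1) pL(2), where c = "d + z \<bullet> f"])
        (auto simp: mem_L inner_diff_left)
    moreover obtain k where k: "v = k *\<^sub>R (y - z)"
      using v by (auto simp: span_singleton)
    moreover have "v \<noteq> 0" using tv by (simp add: tangent_vector_def)
    moreover have "(y - z) \<bullet> f \<noteq> 0"
      using p pL(1) d by (auto simp: mem_open_segment_ray mem_L)
    ultimately show False by auto
  qed
  then show ?thesis
    by (simp add: odd_crossing_def int L_Int_open_segment)
qed

text \<open>The shadow never enters the side opposite to \<open>u\<close>, so it only turns - 1 into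
  1, whence the factor 2. The dividing line is cut out because the shadow may touch it, while
  \<open>chi_hat\<close> is 0 there.\<close>

lemma chi_hat_eq:
  "chi_hat (L \<union> S) u z y = - sgn ((y - z) \<bullet> u)
    + 2 * indicator (shadow z f g d a b \<inter> {y. (y - z) \<bullet> u \<noteq> 0}) y"
proof (cases "(y - z) \<bullet> u" "0::real" rule: linorder_cases)
  case less
  then have "0 < (z - y) \<bullet> u" by (simp add: inner_diff_left)
  then show ?thesis
    using less odd_crossing_iff_shadow[of y] shadow_above[of y]
    by (auto simp: chi_hat_def interior_side_def exterior_side_def)
next
  case equal
  then have "(z - y) \<bullet> u = 0" by (simp add: inner_diff_left)
  then show ?thesis
    using equal by (simp add: chi_hat_def interior_side_def exterior_side_def)
next
  case greater
  then have "(z - y) \<bullet> u < 0" by (simp add: inner_diff_left)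
  then show ?thesis
    using greater odd_crossing_iff_shadow[of y]
    by (auto simp: chi_hat_def interior_side_def exterior_side_def)
qed

end

section \<open>Integrability and the truncated curvature\<close>

text \<open>These are the shadows of the four sides of a square centred at \<open>z\<close> with
  half side \<open>\<epsilon> / 2\<close>. Its half diagonal is \<open>\<epsilon> / sqrt 2\<close>,
  so each point outside the ball is behind some side.\<close>

lemma compl_ball_subset_shadows:
  fixes e u z :: "real^2"
  assumes eu: "norm e = 1" "norm u = 1" "e \<bullet> u = 0" and "0 < \<epsilon>"
  defines "d \<equiv> \<epsilon> / 2"
  shows "- ball z \<epsilon> \<subseteq> shadow z e u d (- d) d \<union> shadow z (- e) u d (- d) d
    \<union> shadow z u e d (- d) d \<union> shadow z (- u) e d (- d) d"
proof
  fix y assume "y \<in> - ball z \<epsilon>"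
  then have n: "\<epsilon> \<le> norm (y - z)" by (simp add: dist_norm norm_minus_commute)
  define q x where "q = (y - z) \<bullet> e" and "x = (y - z) \<bullet> u"
  have d: "0 < d" using assms by simp
  have "norm (y - z) = sqrt (q\<^sup>2 + x\<^sup>2)"
    using norm_orthonormal_combination[OF eu] real2_expand_orthonormal[OF eu, of "y - z"]
    unfolding q_def x_def by metis
  then have "\<epsilon>\<^sup>2 \<le> q\<^sup>2 + x\<^sup>2"
    using n \<open>0 < \<epsilon>\<close> power_mono[of \<epsilon> "norm (y - z)" 2] by simp
  then have "d < \<bar>q\<bar> \<or> d < \<bar>x\<bar>"
  proof (rule contrapos_pp)
    assume "\<not> (d < \<bar>q\<bar> \<or> d < \<bar>x\<bar>)"
    then have "q\<^sup>2 + x\<^sup>2 \<le> d\<^sup>2 + d\<^sup>2"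
      using d by (intro add_mono abs_le_square_iff[THEN iffD1]) auto
    also have "\<dots> < \<epsilon>\<^sup>2"
      using \<open>0 < \<epsilon>\<close> by (simp add: d_def power_divide)
    finally show "\<not> \<epsilon>\<^sup>2 \<le> q\<^sup>2 + x\<^sup>2" by simp
  qed
  then have "d < q \<and> \<bar>x\<bar> \<le> q \<or> d < - q \<and> \<bar>x\<bar> \<le> - q \<or> d < x \<and> \<bar>q\<bar> \<le> x \<or> d < - x \<and> \<bar>q\<bar> \<le> - x"
    by linarith
  moreover have "y \<in> shadow z v w d (- d) d \<longleftrightarrow> d < (y - z) \<bullet> v \<and> \<bar>(y - z) \<bullet> w\<bar> \<le> (y - z) \<bullet> v" for v w
  proof -
    have "- d * s \<le> d * t \<and> d * t \<le> d * s \<longleftrightarrow> \<bar>t\<bar> \<le> s" for s t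
      using mult_le_cancel_left_pos[OF d, of "- s" t] mult_le_cancel_left_pos[OF d, of t s] by auto
    then show ?thesis unfolding shadow_def by blast
  qed
  ultimately show "y \<in> shadow z e u d (- d) d \<union> shadow z (- e) u d (- d) d
    \<union> shadow z u e d (- d) d \<union> shadow z (- u) e d (- d) d"
    by (simp only: Un_iff inner_minus_right q_def x_def) blast
qed

text \<open>The finite shadow integral doubles as a tail bound: four shadows cover the complement of
  the ball, and overlaps only enlarge the sum.\<close>

lemma set_integrable_inverse_powr_compl_ball:
  fixes e u z :: "real^2"
  assumes eu: "norm e = 1" "norm u = 1" "e \<bullet> u = 0" and "0 < \<epsilon>" "0 < \<sigma>"
  shows "set_integrable lborel (- ball z \<epsilon>) (\<lambda>y. 1 / norm (z - y) powr (2 + \<sigma>))"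
proof -
  let ?k = "\<lambda>y. 1 / norm (z - y) powr (2 + \<sigma>)"
  define d where "d = \<epsilon> / 2"
  let ?I = "\<lambda>f g. \<integral>\<^sup>+ y. ennreal (?k y) * indicator (shadow z f g d (- d) d) y \<partial>lborel"
  have meas: "(\<lambda>y. ennreal (?k y) * indicator (shadow z f g d (- d) d) y) \<in> borel_measurable lborel" for f g
    by measurable
  have fin: "?I f g < \<infinity>" if "norm f = 1" "norm g = 1" "f \<bullet> g = 0" for f g
    using nn_integral_shadow[OF that, of d "- d" d \<sigma> z] assms by (simp add: d_def)
  have "(\<integral>\<^sup>+ y. ennreal (norm (indicator (- ball z \<epsilon>) y *\<^sub>R ?k y)) \<partial>lborel)
    \<le> (\<integral>\<^sup>+ y. ennreal (?k y) * indicator (shadow z e u d (- d) d) y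
        + ennreal (?k y) * indicator (shadow z (- e) u d (- d) d) y
        + ennreal (?k y) * indicator (shadow z u e d (- d) d) y
        + ennreal (?k y) * indicator (shadow z (- u) e d (- d) d) y \<partial>lborel)"
  proof (rule nn_integral_mono)
    fix y
    have "indicator (- ball z \<epsilon>) y \<le> (indicator (shadow z e u d (- d) d) y
        + indicator (shadow z (- e) u d (- d) d) y + indicator (shadow z u e d (- d) d) y
        + indicator (shadow z (- u) e d (- d) d) y :: ennreal)"
      using compl_ball_subset_shadows[OF eu \<open>0 < \<epsilon>\<close>, of z]
      by (auto simp: indicator_def d_def)
    moreover have "ennreal (norm (indicator (- ball z \<epsilon>) y *\<^sub>R ?k y)) = ennreal (?k y) * indicator (- ball z \<epsilon>) y"
      by (simp add: indicator_def)
    ultimately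
    show "ennreal (norm (indicator (- ball z \<epsilon>) y *\<^sub>R ?k y))
      \<le> ennreal (?k y) * indicator (shadow z e u d (- d) d) y
        + ennreal (?k y) * indicator (shadow z (- e) u d (- d) d) y
        + ennreal (?k y) * indicator (shadow z u e d (- d) d) y
        + ennreal (?k y) * indicator (shadow z (- u) e d (- d) d) y"
      by (simp only: distrib_left[symmetric] mult_left_mono zero_le)
  qed
  also have "\<dots> = ?I e u + ?I (- e) u + ?I u e + ?I (- u) e"
    by (simp add: nn_integral_add meas borel_measurable_add)
  also have "\<dots> < \<infinity>"
    using fin[of e u] fin[of "- e" u] fin[of u e] fin[of "- u" e] eu by (simp add: inner_commute)
  finally show ?thesis
    unfolding set_integrable_def by (intro integrableI_bounded) auto
qed

lemma integral_lborel_point_reflection: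
  fixes h :: "'a::euclidean_space \<Rightarrow> real"
  assumes [measurable]: "h \<in> borel_measurable borel" and anti: "\<And>y. h (2 *\<^sub>R z - y) = - h y"
  shows "integral\<^sup>L lborel h = 0"
proof -
  have "(lborel :: 'a measure) = distr lborel borel (\<lambda>y. 2 *\<^sub>R z - y)"
    using lborel_affine[of "-1" "2 *\<^sub>R z"] by (simp add: density_1)
  then have "integral\<^sup>L lborel h = integral\<^sup>L (distr lborel borel (\<lambda>y. 2 *\<^sub>R z - y)) h"
    by simp
  also have "\<dots> = (\<integral>y. h (2 *\<^sub>R z - y) \<partial>lborel)"
    by (rule integral_distr) auto
  finally show ?thesis by (simp add: anti)
qed

lemma integral_kernel_nonneg:
  "0 \<le> integral {a..b} (\<lambda>x::real. (d\<^sup>2 + x\<^sup>2) powr c)"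
  \<comment> \<open>A function that is not integrable has integral 0 by default.\<close>
  by (cases "(\<lambda>x. (d\<^sup>2 + x\<^sup>2) powr c) integrable_on {a..b}")
    (auto intro: Henstock_Kurzweil_Integration.integral_nonneg simp: not_integrable_integral)

context segment_frame
begin

text \<open>Integrability is inherited from the bare kernel. Shadow points are farther than
  \<open>d\<close> from \<open>z\<close>, so for \<open>\<epsilon> \<le> d\<close> the ball misses
  the shadow and the truncated value is already final.\<close>

lemma
  assumes eu: "norm e = 1" "norm u = 1" "e \<bullet> u = 0" and \<sigma>: "0 < \<sigma>" and \<epsilon>: "0 < \<epsilon>"
  shows set_integrable_curvature_kernel:
      "set_integrable lebesgue (- ball z \<epsilon>) (curvature_kernel \<sigma> z (L \<union> S) u)"
    and truncated_curvature_segment: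
      "\<epsilon> \<le> d \<Longrightarrow> truncated_curvature \<sigma> z (L \<union> S) u \<epsilon> =
        d / \<sigma> * integral {a..b} (\<lambda>x. (d\<^sup>2 + x\<^sup>2) powr (- (2 + \<sigma>) / 2))"
proof -
  let ?k = "\<lambda>y. 1 / norm (z - y) powr (2 + \<sigma>)"
  let ?sh = "shadow z f g d a b"
  let ?sh' = "?sh \<inter> {y. (y - z) \<bullet> u \<noteq> 0}"
  \<comment> \<open>\<open>h1\<close> is odd under reflection at \<open>z\<close>; \<open>h2\<close>
    lives on the shadow and enters with the factor 2 that cancels the 1/2 in
    \<open>truncated_curvature\<close>.\<close>
  define h1 where "h1 y = indicator (- ball z \<epsilon>) y * (- sgn ((y - z) \<bullet> u) * ?k y)" for y
  define h2 where "h2 y = indicator (- ball z \<epsilon>) y * (indicator ?sh' y * ?k y)" for y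
  have [measurable]: "h1 \<in> borel_measurable borel" "h2 \<in> borel_measurable borel"
    unfolding h1_def h2_def by measurable
  have split: "indicator (- ball z \<epsilon>) y *\<^sub>R curvature_kernel \<sigma> z (L \<union> S) u y = h1 y + 2 * h2 y" for y
    by (simp add: curvature_kernel_def chi_hat_eq h1_def h2_def indicator_def add_divide_distrib diff_divide_distrib)
  have k: "integrable lborel (\<lambda>y. indicator (- ball z \<epsilon>) y *\<^sub>R ?k y)"
    using set_integrable_inverse_powr_compl_ball[OF eu \<epsilon> \<sigma>, of z] by (simp add: set_integrable_def)
  have i1: "integrable lborel h1"
    by (rule Bochner_Integration.integrable_bound[OF k]) (auto simp: h1_def indicator_def sgn_if)
  have i2: "integrable lborel h2"
    by (rule Bochner_Integration.integrable_bound[OF k]) (auto simp: h2_def indicator_def)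
  have meas: "(\<lambda>y. h1 y + 2 * h2 y) \<in> borel_measurable lborel" by measurable
  show "set_integrable lebesgue (- ball z \<epsilon>) (curvature_kernel \<sigma> z (L \<union> S) u)"
    unfolding set_integrable_def split using i1 i2 by (simp add: integrable_completion meas)
  assume "\<epsilon> \<le> d"
  have far: "y \<in> - ball z \<epsilon>" if "y \<in> ?sh" for y
  proof -
    have "d < (y - z) \<bullet> f" using that by (simp add: shadow_def)
    also have "\<dots> \<le> norm (y - z)" using norm_cauchy_schwarz[of "y - z" f] fg by simp
    finally show ?thesis using \<open>\<epsilon> \<le> d\<close> by (simp add: dist_norm norm_minus_commute)
  qed
  have "integral\<^sup>L lborel h1 = 0"
  proof (rule integral_lborel_point_reflection)
    fix y
    have "z - (2 *\<^sub>R z - y) = - (z - y)" "2 *\<^sub>R z - y - z = - (y - z)"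
      by (simp_all add: scaleR_2)
    then show "h1 (2 *\<^sub>R z - y) = - h1 y"
      unfolding h1_def by (simp only: indicator_def Compl_iff mem_ball dist_norm norm_minus_cancel
        inner_minus_left sgn_minus)
  qed measurable
  moreover have "integral\<^sup>L lborel h2 = d / \<sigma> * integral {a..b} (\<lambda>x. (d\<^sup>2 + x\<^sup>2) powr (- (2 + \<sigma>) / 2))"
  proof -
    \<comment> \<open>The dividing line is a null set, so putting it back into the shadow leaves the
      integral unchanged.\<close>
    have "u \<noteq> 0" using eu by auto
    then have "{y. u \<bullet> y = u \<bullet> z} \<in> null_sets lborel"
      using negligible_hyperplane[of u "u \<bullet> z"]
      by (auto simp: negligible_iff_null_sets null_sets_completion_iff closed_hyperplane)
    then have "AE y in lborel. (y - z) \<bullet> u \<noteq> 0"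
      by (rule AE_I') (auto simp: inner_diff_right inner_commute[of _ u])
    then have ae: "AE y in lborel. ennreal (h2 y) = ennreal (?k y) * indicator ?sh y"
      by eventually_elim (use far in \<open>auto simp: h2_def indicator_def\<close>)
    have "integral\<^sup>L lborel h2 = enn2real (\<integral>\<^sup>+ y. ennreal (h2 y) \<partial>lborel)"
      by (rule integral_eq_nn_integral) (auto simp: h2_def)
    also have "(\<integral>\<^sup>+ y. ennreal (h2 y) \<partial>lborel) = (\<integral>\<^sup>+ y. ennreal (?k y) * indicator ?sh y \<partial>lborel)"
      by (rule nn_integral_cong_AE[OF ae])
    also have "\<dots> = ennreal (d / \<sigma> * integral {a..b} (\<lambda>x. (d\<^sup>2 + x\<^sup>2) powr (- (2 + \<sigma>) / 2)))"
      by (rule nn_integral_shadow[OF fg d ab \<sigma>])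
    finally show ?thesis
      using d \<sigma> integral_kernel_nonneg[of a b] by simp
  qed
  moreover have "truncated_curvature \<sigma> z (L \<union> S) u \<epsilon> = 1 / 2 * (\<integral>y. h1 y + 2 * h2 y \<partial>lborel)"
    unfolding truncated_curvature_def set_lebesgue_integral_def split
    by (simp add: integral_completion meas)
  ultimately show "truncated_curvature \<sigma> z (L \<union> S) u \<epsilon> =
      d / \<sigma> * integral {a..b} (\<lambda>x. (d\<^sup>2 + x\<^sup>2) powr (- (2 + \<sigma>) / 2))"
    using i1 i2 by simp
qed

lemma
  assumes eu: "norm e = 1" "norm u = 1" "e \<bullet> u = 0" and \<sigma>: "0 < \<sigma>"
  defines "\<kappa> \<equiv> d / \<sigma> * integral {a..b} (\<lambda>x. (d\<^sup>2 + x\<^sup>2) powr (- (2 + \<sigma>) / 2))"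
  shows curvature_on_exists_segment: "curvature_on_exists \<sigma> z (L \<union> S) u"
    and curvature_on_segment: "curvature_on \<sigma> z (L \<union> S) u = \<kappa>"
proof -
  have "\<forall>\<^sub>F \<epsilon> in at_right 0. truncated_curvature \<sigma> z (L \<union> S) u \<epsilon> = \<kappa>"
    using truncated_curvature_segment[OF eu \<sigma>] d unfolding \<kappa>_def eventually_at_right_field
    by (metis less_imp_le)
  then have lim: "(truncated_curvature \<sigma> z (L \<union> S) u \<longlongrightarrow> \<kappa>) (at_right 0)"
    by (rule tendsto_eventually)
  then show "curvature_on_exists \<sigma> z (L \<union> S) u"
    using set_integrable_curvature_kernel[OF eu \<sigma>] unfolding curvature_on_exists_def by blast
  show "curvature_on \<sigma> z (L \<union> S) u = \<kappa>"
    unfolding curvature_on_def using lim by (intro tendsto_Lim) auto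
qed

end

section \<open>From polar coordinates to the formula\<close>

lemma frame_dir_inner:
  assumes "norm e = 1" "norm u = 1" "e \<bullet> u = 0"
  shows "frame_dir e u \<alpha> \<bullet> frame_dir e u \<beta> = cos (\<alpha> - \<beta>)"
  using assms by (simp add: frame_dir_def inner_add_left inner_add_right inner_commute[of u e]
    norm_eq_1 cos_diff)

lemma frame_dir_expand:
  "frame_dir e u \<theta> = cos (\<theta> - \<phi>) *\<^sub>R frame_dir e u \<phi> + sin (\<theta> - \<phi>) *\<^sub>R frame_dir e u (\<phi> + pi / 2)"
proof -
  have "cos \<theta> = cos (\<theta> - \<phi>) * cos \<phi> - sin (\<theta> - \<phi>) * sin \<phi>"
    "sin \<theta> = cos (\<theta> - \<phi>) * sin \<phi> + sin (\<theta> - \<phi>) * cos \<phi>"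
    using cos_add[of "\<theta> - \<phi>" \<phi>] sin_add[of "\<theta> - \<phi>" \<phi>] by simp_all
  then have "frame_dir e u \<theta> = (cos (\<theta> - \<phi>) * cos \<phi> - sin (\<theta> - \<phi>) * sin \<phi>) *\<^sub>R e
      + (cos (\<theta> - \<phi>) * sin \<phi> + sin (\<theta> - \<phi>) * cos \<phi>) *\<^sub>R u"
    unfolding frame_dir_def by metis
  then show ?thesis
    by (simp add: frame_dir_def cos_add sin_add algebra_simps)
qed

lemma rotate_clockwise_orthogonal: "u \<bullet> rotate_clockwise u = 0"
  by (simp add: rotate_clockwise_def inner_vec_def sum_2)

theorem lemma2:
  fixes \<sigma> r1 r2 rm \<theta>1 \<theta>2 \<theta>m \<theta>p :: real
    and p1 p2 z u e :: "real^2"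
    and L Le :: "(real^2) set"
  assumes sigma: "0 < \<sigma>" "\<sigma> < 1"
    and segment: "p1 \<noteq> p2" "L = closed_segment p1 p2" "Le = affine hull L"
    and z: "z \<notin> Le"
    and u: "norm u = 1"
    and half_plane: "L \<subseteq> {p. (p - z) \<bullet> u \<ge> 0}"
    and frame: "norm e = 1" "e \<bullet> u = 0"
    and polar1: "p1 = z + r1 *\<^sub>R frame_dir e u \<theta>1" "r1 > 0" "\<theta>1 \<in> {0..pi}"
    and polar2: "p2 = z + r2 *\<^sub>R frame_dir e u \<theta>2" "r2 > 0" "\<theta>2 \<in> {0..pi}"
    and labels: "\<theta>1 \<le> \<theta>2"
    and polarm: "midpoint p1 p2 = z + rm *\<^sub>R frame_dir e u \<theta>m" "rm > 0" "\<theta>m \<in> {0..pi}"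
    and perp: "\<theta>p \<in> {- pi / 2<..<3 * pi / 2}"
      "\<exists>s\<ge>0. z + s *\<^sub>R frame_dir e u \<theta>p \<in> Le"
      "frame_dir e u \<theta>p \<bullet> (p2 - p1) = 0"
  shows "nonlocal_curvature_exists \<sigma> z L u \<and>
    nonlocal_curvature \<sigma> z L u =
      (1 / cos (\<theta>m - \<theta>p)) powr \<sigma> / (\<sigma> * rm powr \<sigma>) *
      (Psi \<sigma> (sin (\<theta>2 - \<theta>p)) - Psi \<sigma> (sin (\<theta>1 - \<theta>p)))"
proof -
  define f g where "f = frame_dir e u \<theta>p" and "g = frame_dir e u (\<theta>p + pi / 2)"
  note eu = frame(1) u frame(2)
  have fg: "norm f = 1" "norm g = 1" "f \<bullet> g = 0"
    by (simp_all add: f_def g_def norm_eq_1 frame_dir_inner[OF eu])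
  have inner_f: "frame_dir e u \<theta> \<bullet> f = cos (\<theta> - \<theta>p)" for \<theta>
    by (simp add: f_def frame_dir_inner[OF eu])
  \<comment> \<open>\<open>d\<close> is the distance from \<open>z\<close> to \<open>Le\<close>,
    obtained as the radius of the foot of the perpendicular; it is nonzero because \<open>z\<close>
    is off \<open>Le\<close>.\<close>
  obtain d where "0 \<le> d" and foot: "z + d *\<^sub>R f \<in> Le"
    using perp(2) by (auto simp: f_def)
  with z have d: "0 < d" by (cases "d = 0") auto
  have "L \<subseteq> {y. f \<bullet> y = f \<bullet> p1}"
  proof -
    have "p1 \<in> {y. f \<bullet> y = f \<bullet> p1}" "p2 \<in> {y. f \<bullet> y = f \<bullet> p1}"
      using perp(3) by (simp_all add: f_def inner_diff_right)
    then show ?thesis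
      unfolding segment(2) by (intro closed_segment_subset convex_hyperplane)
  qed
  then have Le: "Le \<subseteq> {y. f \<bullet> y = f \<bullet> p1}"
    unfolding segment(3) by (intro hull_minimal affine_hyperplane)
  have dist: "(y - z) \<bullet> f = d" if "y \<in> Le" for y
  proof -
    have "f \<bullet> y = f \<bullet> (z + d *\<^sub>R f)" using subsetD[OF Le that] subsetD[OF Le foot] by (simp only: mem_Collect_eq)
    then have "f \<bullet> (y - z) = d"
      using fg(1) by (simp add: inner_diff_right inner_add_right norm_eq_1)
    then show ?thesis by (simp only: inner_commute)
  qed
  have "L \<subseteq> Le" unfolding segment(3) by (rule hull_subset)
  then have in_Le: "p1 \<in> Le" "p2 \<in> Le" "midpoint p1 p2 \<in> Le"
    unfolding segment(2) by auto
  \<comment> \<open>This is the polar equation of \<open>Le\<close> at both ends and at the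
    midpoint.\<close>
  have r1: "r1 * cos (\<theta>1 - \<theta>p) = d" and r2: "r2 * cos (\<theta>2 - \<theta>p) = d"
    and rm: "rm * cos (\<theta>m - \<theta>p) = d"
    using dist[OF in_Le(1)] dist[OF in_Le(2)] dist[OF in_Le(3)]
    by (simp_all add: polar1(1) polar2(1) polarm(1)[unfolded polar1(1) polar2(1)] inner_f)
  define a b where "a = r1 * sin (\<theta>1 - \<theta>p)" and "b = r2 * sin (\<theta>2 - \<theta>p)"
  have p1: "p1 = z + (d *\<^sub>R f + a *\<^sub>R g)"
    unfolding polar1(1) frame_dir_expand[of e u \<theta>1 \<theta>p] f_def[symmetric] g_def[symmetric]
      r1[symmetric] a_def by (simp add: scaleR_add_right)
  have p2: "p2 = z + (d *\<^sub>R f + b *\<^sub>R g)"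
    unfolding polar2(1) frame_dir_expand[of e u \<theta>2 \<theta>p] f_def[symmetric] g_def[symmetric]
      r2[symmetric] b_def by (simp add: scaleR_add_right)
  have ab: "a \<le> b"
  proof -
    \<comment> \<open>Both angles lie in \<open>{0..pi}\<close>. Expanding this sine around
      \<open>\<theta>p\<close> and multiplying by \<open>r1 * r2\<close> gives
      \<open>d * (b - a)\<close>, so the labelling by angle orders the coordinates along
      \<open>g\<close>.\<close>
    have "0 \<le> sin (\<theta>2 - \<theta>1)"
      using labels polar1(3) polar2(3) by (intro sin_ge_zero) auto
    also have "\<theta>2 - \<theta>1 = (\<theta>2 - \<theta>p) - (\<theta>1 - \<theta>p)" by simp
    finally have "0 \<le> r1 * r2 * (sin (\<theta>2 - \<theta>p) * cos (\<theta>1 - \<theta>p) - cos (\<theta>2 - \<theta>p) * sin (\<theta>1 - \<theta>p))"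
      unfolding sin_diff[of "\<theta>2 - \<theta>p"] using polar1(2) polar2(2) by simp
    also have "\<dots> = b * (r1 * cos (\<theta>1 - \<theta>p)) - (r2 * cos (\<theta>2 - \<theta>p)) * a"
      by (simp add: a_def b_def algebra_simps)
    finally show ?thesis unfolding r1 r2 using d by simp
  qed
  \<comment> \<open>Hence \<open>a / sqrt (d\<^sup>2 + a\<^sup>2)\<close> is
    \<open>sin (\<theta>1 - \<theta>p)\<close>, and likewise for \<open>b\<close>: these are the
    arguments of \<open>Psi\<close>.\<close>
  have radius: "sqrt (d\<^sup>2 + (r * sin t)\<^sup>2) = r" if "0 < r" "r * cos t = d" for r t
  proof -
    have "d\<^sup>2 + (r * sin t)\<^sup>2 = r\<^sup>2 * ((cos t)\<^sup>2 + (sin t)\<^sup>2)"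
      unfolding that(2)[symmetric] by (simp only: power_mult_distrib distrib_left)
    also have "\<dots> = r\<^sup>2" by (simp only: sin_cos_squared_add2 mult_1_right)
    finally show ?thesis using that(1) by simp
  qed
  \<comment> \<open>For every \<open>\<delta>\<close> the added segment lies on the line through
    \<open>z\<close> orthogonal to \<open>u\<close>, so the curvature is the same for all
    \<open>\<delta>\<close> and its limit is that of a constant.\<close>
  have frame': "segment_frame z u f g a b d L
      (closed_segment (z - \<delta> *\<^sub>R rotate_clockwise u) (z + \<delta> *\<^sub>R rotate_clockwise u))" for \<delta>
  proof
    show "(p - z) \<bullet> u = 0"
      if "p \<in> closed_segment (z - \<delta> *\<^sub>R rotate_clockwise u) (z + \<delta> *\<^sub>R rotate_clockwise u)" for p
    proof -
      have "closed_segment (z - \<delta> *\<^sub>R rotate_clockwise u) (z + \<delta> *\<^sub>R rotate_clockwise u)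
          \<subseteq> {p. u \<bullet> p = u \<bullet> z}"
        by (intro closed_segment_subset convex_hyperplane)
          (auto simp: inner_diff_right inner_add_right rotate_clockwise_orthogonal)
      with that show ?thesis by (auto simp: inner_diff_right inner_commute[of _ u])
    qed
  qed (use fg d ab half_plane segment(2) p1 p2 in auto)
  define \<kappa> where "\<kappa> = d / \<sigma> * integral {a..b} (\<lambda>x. (d\<^sup>2 + x\<^sup>2) powr (- (2 + \<sigma>) / 2))"
  have ex: "curvature_on_exists \<sigma> z (add_segment L z u \<delta>) u"
    and val: "curvature_on \<sigma> z (add_segment L z u \<delta>) u = \<kappa>" for \<delta>
    unfolding add_segment_def \<kappa>_def
    using segment_frame.curvature_on_exists_segment[OF frame' eu sigma(1)]
      segment_frame.curvature_on_segment[OF frame' eu sigma(1)] by blast+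
  have "z \<notin> L" using z \<open>L \<subseteq> Le\<close> by blast
  then have "nonlocal_curvature_exists \<sigma> z L u" "nonlocal_curvature \<sigma> z L u = \<kappa>"
    unfolding nonlocal_curvature_exists_def nonlocal_curvature_def
    using ex val by (auto intro!: tendsto_Lim)
  moreover have "\<kappa> = (1 / cos (\<theta>m - \<theta>p)) powr \<sigma> / (\<sigma> * rm powr \<sigma>) *
      (Psi \<sigma> (sin (\<theta>2 - \<theta>p)) - Psi \<sigma> (sin (\<theta>1 - \<theta>p)))"
  proof -
    have "\<kappa> = d / \<sigma> * (d powr (- \<sigma> - 1) * (Psi \<sigma> (sin (\<theta>2 - \<theta>p)) - Psi \<sigma> (sin (\<theta>1 - \<theta>p))))"
      unfolding \<kappa>_def integral_kernel_eq_Psi[OF d ab]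
      using polar1(2) polar2(2) radius[OF _ r1] radius[OF _ r2] by (simp add: a_def b_def)
    also have "\<dots> = (d * d powr (- \<sigma> - 1)) / \<sigma> * (Psi \<sigma> (sin (\<theta>2 - \<theta>p)) - Psi \<sigma> (sin (\<theta>1 - \<theta>p)))"
      by simp
    also have "d * d powr (- \<sigma> - 1) = 1 / d powr \<sigma>"
      using d powr_mult_base[of d "- \<sigma> - 1"] by (simp add: powr_minus_divide)
    \<comment> \<open>Replacing \<open>d\<close> through the polar equation of the midpoint produces
      \<open>rm\<close> and the secant.\<close>
    also have "d powr \<sigma> = rm powr \<sigma> * cos (\<theta>m - \<theta>p) powr \<sigma>"
      unfolding rm[symmetric] by (simp add: powr_mult)
    finally show ?thesis
      by (simp add: powr_divide field_simps)
  qed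
  ultimately show ?thesis by simp
qed

end
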